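(* Let $N\ge1$ and choose the basis $\Phi_N=\{P_k\}_{k=0}^N$ of shifted Legendre polynomials on $[-\tau,0]$. Then the Lanczos tau discretization $$\begin{pmatrix}\varepsilon_0\\ \mathcal T_{N-1}\end{pmatrix}\tfrac{d}{dt}\xi_{tN}=\begin{pmatrix}A_0\varepsilon_0+A_1\varepsilon_{-\tau}\\ \mathcal D\end{pmatrix}\xi_{tN}+\begin{pmatrix}B\\ \mathbf 0\end{pmatrix}\mathbf u(t),\qquad \mathbf y_N(t)=C\varepsilon_0\xi_{tN},\qquad \xi_{tN}\in\mathbb P_N^n,$$ is a state space representation of the transfer function $G(s)=C(sI_n-A_0-A_1e^{-s\tau})^{-1}B$ in which the exponential $s\mapsto e^{-\tau s}$ is replaced by a Padé approximant of type $(N,N)$ around zero. That is, its transfer function $$G_N(s)=C\,\varepsilon_0\begin{pmatrix} s\varepsilon_0-A_0\varepsilon_0-A_1\varepsilon_{-\tau}\\ s\mathcal T_{N-1}-\mathcal D\end{pmatrix}^{-1}\begin{pmatrix}B\\ \mathbf 0\end{pmatrix}$$ satisfies, as rational functions of $s$, $G_N(s)=C\bigl(sI_n-A_0-A_1R(s)\bigr)^{-1}B$, where $R$ is an $(N,N)$ Padé approximant of $e^{-\tau s}$ around zero.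
   Context: Let $\tau>0$, $A_0,A_1\in\mathbb C^{n\times n}$, $B\in\mathbb C^{n\times p}$, $C\in\mathbb C^{q\times n}$; the original time-delay system is $\dot{\mathbf x}(t)=A_0\mathbf x(t)+A_1\mathbf x(t-\tau)+B\mathbf u(t)$, $\mathbf y(t)=C\mathbf x(t)$, with transfer function $G$. The shifted Legendre polynomials $P_k$ are the polynomials of degree $k$ orthogonal with respect to $\langle f,g\rangle=\int_{-\tau}^0 f(\theta)\overline{g(\theta)}\,d\theta$, normalized by $P_k(0)=1$; $\|f\|=\sqrt{\langle f,f\rangle}$. $\mathbb P_N^n$ denotes the $\mathbb C^n$-valued polynomials on $[-\tau,0]$ of degree at most $N$; $\varepsilon_\theta f=f(\theta)$; $\mathcal D f=f'$; $\mathcal T_{N-1}:\mathbb P_N^n\to\mathbb P_{N-1}^n$ acts on each component $f$ by $\mathcal T_{N-1}f=f-\frac{\langle f,P_N\rangle}{\|P_N\|^2}P_N$. The column of operators in $G_N(s)$ is a linear map $\mathbb P_N^n\to\mathbb C^n\times\mathbb P_{N-1}^n$, invertible for all but finitely many $s$, and $\begin{pmatrix}B\\ \mathbf 0\end{pmatrix}\mathbf v=(B\mathbf v,\mathbf 0)$ with $\mathbf 0$ the zero polynomial. A rational function $R$ is an $(N,N)$ Padé approximant of $e^{-\tau s}$ around zero if it is a quotient of two polynomials of degree at most $N$, is analytic at $0$, and $R^{(m)}(0)=(-\tau)^m$ for all $0\le m\le 2N$. *)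

theory Defs
  imports "HOL-Analysis.Analysis" "HOL-Computational_Algebra.Polynomial"
begin

section \<open>Shifted Legendre polynomials\<close>

text \<open>Polynomial functions on the nondegenerate interval \<open>[-\<tau>, 0]\<close> are identified with
  formal polynomials over \<open>\<complex>\<close>.\<close>

definition poly_inner :: "real \<Rightarrow> complex poly \<Rightarrow> complex poly \<Rightarrow> complex" where
  "poly_inner \<tau> f g =
     integral {-\<tau>..0} (\<lambda>\<theta>. poly f (complex_of_real \<theta>) * cnj (poly g (complex_of_real \<theta>)))"

text \<open>\<open>poly_inner \<tau> f f\<close> is real and nonnegative, so \<open>Re\<close> only converts the type.\<close>

definition poly_norm :: "real \<Rightarrow> complex poly \<Rightarrow> real" where
  "poly_norm \<tau> f = sqrt (Re (poly_inner \<tau> f f))"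

definition is_shifted_legendre :: "real \<Rightarrow> (nat \<Rightarrow> complex poly) \<Rightarrow> bool" where
  "is_shifted_legendre \<tau> P \<longleftrightarrow>
     (\<forall>k. degree (P k) = k \<and> poly (P k) 0 = 1) \<and>
     (\<forall>j k. j \<noteq> k \<longrightarrow> poly_inner \<tau> (P j) (P k) = 0)"

definition shifted_legendre :: "real \<Rightarrow> nat \<Rightarrow> complex poly" where
  "shifted_legendre \<tau> = (THE P. is_shifted_legendre \<tau> P)"

section \<open>Lanczos tau discretization\<close>

text \<open>A \<open>\<complex>\<^sup>n\<close>-valued polynomial is the vector of its component polynomials.\<close>

definition vec_polys :: "nat \<Rightarrow> (complex poly ^ 'n) set" where
  "vec_polys N = {\<xi>. \<forall>i. degree (\<xi> $ i) \<le> N}"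

definition eval_at :: "real \<Rightarrow> complex poly ^ 'n \<Rightarrow> complex ^ 'n" where
  "eval_at \<theta> \<xi> = (\<chi> i. poly (\<xi> $ i) (complex_of_real \<theta>))"

definition vec_pderiv :: "complex poly ^ 'n \<Rightarrow> complex poly ^ 'n" where
  "vec_pderiv \<xi> = (\<chi> i. pderiv (\<xi> $ i))"

text \<open>\<open>tau_trunc \<tau> N\<close> is \<open>\<T>\<^bsub>N-1\<^esub>\<close>: it removes the component along \<open>P\<^sub>N\<close>.\<close>

definition tau_trunc :: "real \<Rightarrow> nat \<Rightarrow> complex poly ^ 'n \<Rightarrow> complex poly ^ 'n" where
  "tau_trunc \<tau> N \<xi> = (\<chi> i. \<xi> $ i -
     smult (poly_inner \<tau> (\<xi> $ i) (shifted_legendre \<tau> N)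
              / complex_of_real ((poly_norm \<tau> (shifted_legendre \<tau> N))\<^sup>2))
           (shifted_legendre \<tau> N))"

text \<open>The discretization is the descriptor system \<open>E \<xi>' = A \<xi> + B\<^sub>0 u\<close>, \<open>y = C \<epsilon>\<^sub>0 \<xi>\<close> on
  polynomials of degree at most \<open>N\<close>, where \<open>E\<close>, \<open>A\<close>, \<open>B\<^sub>0\<close>, \<open>C \<epsilon>\<^sub>0\<close> are the following four
  operators.\<close>

definition tau_E :: "real \<Rightarrow> nat \<Rightarrow> complex poly ^ 'n \<Rightarrow> (complex ^ 'n) \<times> (complex poly ^ 'n)" where
  "tau_E \<tau> N \<xi> = (eval_at 0 \<xi>, tau_trunc \<tau> N \<xi>)"

definition tau_A :: "real \<Rightarrow> complex ^ 'n ^ 'n \<Rightarrow> complex ^ 'n ^ 'n \<Rightarrow>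
    complex poly ^ 'n \<Rightarrow> (complex ^ 'n) \<times> (complex poly ^ 'n)" where
  "tau_A \<tau> A0 A1 \<xi> = (A0 *v eval_at 0 \<xi> + A1 *v eval_at (-\<tau>) \<xi>, vec_pderiv \<xi>)"

definition tau_B :: "complex ^ 'p ^ 'n \<Rightarrow> complex ^ 'p \<Rightarrow> (complex ^ 'n) \<times> (complex poly ^ 'n)" where
  "tau_B B v = (B *v v, 0)"

definition tau_C :: "complex ^ 'n ^ 'q \<Rightarrow> complex poly ^ 'n \<Rightarrow> complex ^ 'q" where
  "tau_C C \<xi> = C *v eval_at 0 \<xi>"

text \<open>The operator \<open>s E - A\<close>; \<open>[:s:]\<close> is the constant polynomial \<open>s\<close>.\<close>

definition tau_pencil :: "real \<Rightarrow> nat \<Rightarrow> complex ^ 'n ^ 'n \<Rightarrow> complex ^ 'n ^ 'n \<Rightarrow> complex \<Rightarrow>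
    complex poly ^ 'n \<Rightarrow> (complex ^ 'n) \<times> (complex poly ^ 'n)" where
  "tau_pencil \<tau> N A0 A1 s \<xi> =
     (s *s fst (tau_E \<tau> N \<xi>), [:s:] *s snd (tau_E \<tau> N \<xi>)) - tau_A \<tau> A0 A1 \<xi>"

lemma tau_pencil_eq:
  "tau_pencil \<tau> N A0 A1 s \<xi> =
     (s *s eval_at 0 \<xi> - A0 *v eval_at 0 \<xi> - A1 *v eval_at (-\<tau>) \<xi>,
      [:s:] *s tau_trunc \<tau> N \<xi> - vec_pderiv \<xi>)"
  by (simp add: tau_pencil_def tau_E_def tau_A_def)

text \<open>The transfer function \<open>G\<^sub>N(s)\<close>, as an operator on input vectors. It is meaningful only
  where the pencil is a bijection from \<open>vec_polys N\<close> onto \<open>UNIV \<times> vec_polys (N - 1)\<close>.\<close>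

definition tau_transfer :: "real \<Rightarrow> nat \<Rightarrow> complex ^ 'n ^ 'n \<Rightarrow> complex ^ 'n ^ 'n \<Rightarrow>
    complex ^ 'p ^ 'n \<Rightarrow> complex ^ 'n ^ 'q \<Rightarrow> complex \<Rightarrow> complex ^ 'p \<Rightarrow> complex ^ 'q" where
  "tau_transfer \<tau> N A0 A1 B C s v =
     tau_C C (inv_into (vec_polys N) (tau_pencil \<tau> N A0 A1 s) (tau_B B v))"

section \<open>Delay transfer function and Pad\'e approximants\<close>

text \<open>With \<open>\<phi> s = exp (-\<tau> s)\<close>, \<open>delay_transfer A0 A1 B C \<phi>\<close> is the transfer function of the
  time-delay system; replacing the exponential means choosing another \<open>\<phi>\<close>.\<close>

definition delay_matrix :: "complex ^ 'n ^ 'n \<Rightarrow> complex ^ 'n ^ 'n \<Rightarrow> (complex \<Rightarrow> complex) \<Rightarrow>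
    complex \<Rightarrow> complex ^ 'n ^ 'n" where
  "delay_matrix A0 A1 \<phi> s = mat s - A0 - A1 ** mat (\<phi> s)"

definition delay_transfer :: "complex ^ 'n ^ 'n \<Rightarrow> complex ^ 'n ^ 'n \<Rightarrow>
    complex ^ 'p ^ 'n \<Rightarrow> complex ^ 'n ^ 'q \<Rightarrow> (complex \<Rightarrow> complex) \<Rightarrow> complex \<Rightarrow> complex ^ 'p ^ 'q" where
  "delay_transfer A0 A1 B C \<phi> s = C ** matrix_inv (delay_matrix A0 A1 \<phi> s) ** B"

text \<open>A rational function is represented by a total function agreeing with a quotient of
  polynomials off the zeros of the denominator. Analyticity at \<open>0\<close> is required of that
  function, so a common zero of numerator and denominator at \<open>0\<close> is allowed if removed.\<close>

definition is_pade_exp :: "real \<Rightarrow> nat \<Rightarrow> (complex \<Rightarrow> complex) \<Rightarrow> bool" where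
  "is_pade_exp \<tau> N R \<longleftrightarrow>
     (\<exists>p q. q \<noteq> 0 \<and> degree p \<le> N \<and> degree q \<le> N \<and>
        (\<forall>s. poly q s \<noteq> 0 \<longrightarrow> R s = poly p s / poly q s)) \<and>
     R analytic_on {0} \<and>
     (\<forall>m \<le> 2 * N. (deriv ^^ m) R 0 = (- complex_of_real \<tau>) ^ m)"

end

theory Submission
  imports Defs
begin

text \<open>On each component the tau equation with zero polynomial input reads \<open>s x - x' = s a L\<close>,
  where \<open>L = P\<^sub>N\<close> and \<open>a\<close> is the coefficient of \<open>x\<close> along \<open>L\<close>. For \<open>s \<noteq> 0\<close> its solutions are
  the multiples of \<open>r = (\<Sum>k\<le>N. s\<^bsup>-k\<^esup> L\<^bsup>(k)\<^esup>)\<close>, so \<open>\<epsilon>\<^bsub>-\<tau>\<^esub> \<xi> = R(s) \<epsilon>\<^sub>0 \<xi>\<close> with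
  \<open>R(s) = r(-\<tau>) / r(0)\<close>, and the boundary row becomes \<open>(s I - A\<^sub>0 - A\<^sub>1 R(s)) \<epsilon>\<^sub>0 \<xi> = B v\<close>.
  By Rodrigues' formula \<open>L\<close> is a multiple of \<open>w\<^bsup>(N)\<^esup>\<close> with \<open>w(\<theta>) = \<theta>\<^sup>N (\<theta> + \<tau>)\<^sup>N\<close>. As the
  derivatives of \<open>w\<close> of order below \<open>N\<close> vanish at both end points, numerator and denominator of
  \<open>R\<close> may be replaced by \<open>\<Sum>m\<le>2N. s\<^sup>m w\<^bsup>(2N-m)\<^esup>(\<theta>)\<close> at \<open>\<theta> = -\<tau>\<close> and \<open>\<theta> = 0\<close>, and Taylor's
  formula from \<open>0\<close> to \<open>-\<tau>\<close> gives the Pad\'e property coefficient by coefficient.\<close>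

section \<open>Higher derivatives of polynomials\<close>

lemma coeff_eq_higher_pderiv:
  fixes f :: "'a::field_char_0 poly"
  shows "coeff f m = poly ((pderiv ^^ m) f) 0 / fact m"
  by (simp add: poly_0_coeff_0 coeff_higher_pderiv pochhammer_fact[symmetric])

text \<open>Vanishing coefficients take the place of a strict degree bound so that
  \<open>n = 0\<close>, where \<open>f\<close> must be zero, is covered.\<close>

lemma higher_pderiv_eq_0:
  assumes "\<And>i. i \<ge> n \<Longrightarrow> coeff f i = 0"
  shows "(pderiv ^^ n) f = 0"
  by (rule poly_eqI) (simp add: coeff_higher_pderiv assms)

lemma power_dvd_pderiv:
  fixes p f :: "'a::idom poly"
  assumes "p ^ Suc n dvd f"
  shows "p ^ n dvd pderiv f"
proof -
  obtain g where f: "f = p ^ Suc n * g" using assms by blast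
  show ?thesis
    unfolding f pderiv_mult pderiv_power_Suc
    by (intro dvd_add) (auto simp: dvd_smult)
qed

lemma power_dvd_higher_pderiv:
  fixes p f :: "'a::idom poly"
  assumes "p ^ n dvd f" "j \<le> n"
  shows "p ^ (n - j) dvd (pderiv ^^ j) f"
  using \<open>j \<le> n\<close>
proof (induction j)
  case (Suc j)
  then have "p ^ Suc (n - Suc j) dvd (pderiv ^^ j) f"
    by (simp add: Suc_diff_Suc)
  then show ?case by (simp add: power_dvd_pderiv)
qed (simp add: assms)

lemma poly_higher_pderiv_multiple_root:
  fixes p f :: "'a::idom poly"
  assumes "p ^ n dvd f" "j < n" "poly p x = 0"
  shows "poly ((pderiv ^^ j) f) x = 0"
proof -
  have "p dvd p ^ (n - j)" using \<open>j < n\<close> by (simp add: dvd_power)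
  also have "\<dots> dvd (pderiv ^^ j) f" using assms by (intro power_dvd_higher_pderiv) auto
  finally show ?thesis using assms(3) by (metis poly_eq_0_iff_dvd dvd_trans)
qed

section \<open>The inner product\<close>

lemma continuous_on_poly_of_real:
  "continuous_on A (\<lambda>\<theta>. poly f (complex_of_real \<theta>))"
  by (intro continuous_intros)

lemma poly_integrable [simp]:
  "(\<lambda>\<theta>. poly f (complex_of_real \<theta>)) integrable_on {a..b}"
  by (intro integrable_continuous_interval continuous_on_poly_of_real)

lemma integral_pderiv:
  assumes "a \<le> b"
  shows "integral {a..b} (\<lambda>\<theta>. poly (pderiv f) (complex_of_real \<theta>)) =
    poly f (of_real b) - poly f (of_real a)"
  by (intro integral_unique fundamental_theorem_of_calculus assms
      has_vector_derivative_real_field poly_DERIV)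

text \<open>Integration by parts \<open>m\<close> times: every boundary term vanishes and all
  derivatives end up on \<open>g\<close>.\<close>

lemma integral_higher_pderiv_mult_eq_0:
  assumes "a \<le> b"
    and "\<And>i. i < m \<Longrightarrow> poly ((pderiv ^^ i) f) (of_real a) = 0"
    and "\<And>i. i < m \<Longrightarrow> poly ((pderiv ^^ i) f) (of_real b) = 0"
    and "(pderiv ^^ m) g = 0"
  shows "integral {a..b} (\<lambda>\<theta>. poly ((pderiv ^^ m) f * g) (complex_of_real \<theta>)) = 0"
  using assms(2-)
proof (induction m arbitrary: g)
  case (Suc m)
  have IH: "integral {a..b} (\<lambda>\<theta>. poly ((pderiv ^^ m) f * pderiv g) (complex_of_real \<theta>)) = 0"
    using Suc.prems by (intro Suc.IH) (simp_all add: funpow_swap1)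
  have *: "(pderiv ^^ Suc m) f * g = pderiv ((pderiv ^^ m) f * g) - (pderiv ^^ m) f * pderiv g"
    by (simp add: pderiv_mult algebra_simps)
  have "integral {a..b} (\<lambda>\<theta>. poly ((pderiv ^^ Suc m) f * g) (complex_of_real \<theta>)) =
    integral {a..b} (\<lambda>\<theta>. poly (pderiv ((pderiv ^^ m) f * g)) (complex_of_real \<theta>)) -
    integral {a..b} (\<lambda>\<theta>. poly ((pderiv ^^ m) f * pderiv g) (complex_of_real \<theta>))"
    unfolding * poly_diff by (intro Henstock_Kurzweil_Integration.integral_diff poly_integrable)
  also have "\<dots> = 0"
    unfolding integral_pderiv[OF assms(1)] IH using Suc.prems by simp
  finally show ?case .
qed simp

text \<open>On real arguments, conjugating values amounts to conjugating coefficients, so the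
  integrand is itself a polynomial and can be integrated by parts.\<close>

lemma poly_inner_eq:
  "poly_inner \<tau> f g = integral {-\<tau>..0} (\<lambda>\<theta>. poly (f * map_poly cnj g) (complex_of_real \<theta>))"
  by (simp add: poly_inner_def poly_map_poly_cnj)

lemma poly_inner_add_left: "poly_inner \<tau> (f + g) h = poly_inner \<tau> f h + poly_inner \<tau> g h"
  unfolding poly_inner_eq distrib_right poly_add
  by (intro Henstock_Kurzweil_Integration.integral_add poly_integrable)

lemma poly_inner_smult_left: "poly_inner \<tau> (smult c f) h = c * poly_inner \<tau> f h"
  by (simp add: poly_inner_def mult.assoc)

lemma poly_inner_diff_left: "poly_inner \<tau> (f - g) h = poly_inner \<tau> f h - poly_inner \<tau> g h"
  using poly_inner_add_left[of \<tau> f "- g" h] poly_inner_smult_left[of \<tau> "-1" g h] by simp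

lemma poly_inner_0_left [simp]: "poly_inner \<tau> 0 h = 0"
  by (simp add: poly_inner_def)

lemma poly_inner_commute: "poly_inner \<tau> g f = cnj (poly_inner \<tau> f g)"
  by (simp add: poly_inner_def integral_cnj mult.commute)

lemma poly_inner_self:
  "poly_inner \<tau> f f = of_real (integral {-\<tau>..0} (\<lambda>\<theta>. (cmod (poly f (complex_of_real \<theta>)))\<^sup>2))"
proof -
  have "(\<lambda>\<theta>. (cmod (poly f (complex_of_real \<theta>)))\<^sup>2) integrable_on {-\<tau>..0}"
    by (intro integrable_continuous_interval continuous_intros)
  from integral_linear[OF this bounded_linear_of_real]
  show ?thesis
    by (simp add: poly_inner_def o_def flip: complex_norm_square)
qed

text \<open>A continuous nonnegative integrand with integral zero vanishes on the whole interval,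
  which gives \<open>f\<close> infinitely many roots.\<close>

lemma poly_inner_self_eq_0_iff:
  assumes "\<tau> > 0"
  shows "poly_inner \<tau> f f = 0 \<longleftrightarrow> f = 0"
proof
  assume "poly_inner \<tau> f f = 0"
  then have "integral {-\<tau>..0} (\<lambda>\<theta>. (cmod (poly f (complex_of_real \<theta>)))\<^sup>2) = 0"
    by (simp add: poly_inner_self)
  moreover have "continuous_on {-\<tau>..0} (\<lambda>\<theta>. (cmod (poly f (complex_of_real \<theta>)))\<^sup>2)"
    by (intro continuous_intros)
  ultimately have "\<forall>\<theta>\<in>{-\<tau>..0}. (cmod (poly f (complex_of_real \<theta>)))\<^sup>2 = 0"
    using assms by (subst (asm) integral_eq_0_iff) auto
  then have "complex_of_real ` {-\<tau>..0} \<subseteq> {x. poly f x = 0}"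
    by auto
  moreover have "infinite (complex_of_real ` {-\<tau>..0})"
    using assms by (subst finite_image_iff) (auto simp: inj_on_def)
  ultimately show "f = 0"
    using poly_roots_finite infinite_super by blast
qed simp

lemma poly_norm_square: "(complex_of_real (poly_norm \<tau> f))\<^sup>2 = poly_inner \<tau> f f"
proof -
  have "integral {-\<tau>..0} (\<lambda>\<theta>. (cmod (poly f (complex_of_real \<theta>)))\<^sup>2) \<ge> 0"
    by (intro integral_nonneg integrable_continuous_interval continuous_intros) auto
  then show ?thesis
    by (simp add: poly_norm_def poly_inner_self flip: of_real_power)
qed

section \<open>Legendre polynomials by Rodrigues' formula\<close>

definition rodrigues_weight :: "real \<Rightarrow> nat \<Rightarrow> complex poly" where
  "rodrigues_weight \<tau> k = monom 1 k * [:of_real \<tau>, 1:] ^ k"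

text \<open>The scalar normalizes the value at 0 to 1, because the weight has coefficient
  \<open>\<tau> ^ k\<close> at \<open>k\<close>.\<close>

definition rodrigues :: "real \<Rightarrow> nat \<Rightarrow> complex poly" where
  "rodrigues \<tau> k = smult (1 / (fact k * of_real \<tau> ^ k)) ((pderiv ^^ k) (rodrigues_weight \<tau> k))"

lemma degree_rodrigues_weight: "degree (rodrigues_weight \<tau> k) = 2 * k"
  by (simp add: rodrigues_weight_def degree_mult_eq degree_power_eq degree_monom_eq)

lemma poly_rodrigues_weight_at_0:
  assumes "j < k"
  shows "poly ((pderiv ^^ j) (rodrigues_weight \<tau> k)) 0 = 0"
proof (rule poly_higher_pderiv_multiple_root[where n = k and p = "[:0, 1:]"])
  show "[:0, 1:] ^ k dvd rodrigues_weight \<tau> k"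
    by (simp add: rodrigues_weight_def monom_altdef)
qed (use assms in auto)

lemma poly_rodrigues_weight_at_minus_tau:
  assumes "j < k"
  shows "poly ((pderiv ^^ j) (rodrigues_weight \<tau> k)) (- of_real \<tau>) = 0"
proof (rule poly_higher_pderiv_multiple_root[where n = k and p = "[:of_real \<tau>, 1:]"])
  show "[:of_real \<tau>, 1:] ^ k dvd rodrigues_weight \<tau> k"
    by (simp add: rodrigues_weight_def)
qed (use assms in auto)

lemma degree_rodrigues:
  assumes "\<tau> \<noteq> 0"
  shows "degree (rodrigues \<tau> k) = k"
  using assms by (simp add: rodrigues_def degree_higher_pderiv degree_rodrigues_weight)

lemma poly_rodrigues_0:
  assumes "\<tau> \<noteq> 0"
  shows "poly (rodrigues \<tau> k) 0 = 1"
proof -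
  have "coeff (rodrigues_weight \<tau> k) k = of_real \<tau> ^ k"
    by (simp add: rodrigues_weight_def coeff_monom_mult poly_power flip: poly_0_coeff_0)
  then show ?thesis
    using assms by (simp add: rodrigues_def coeff_eq_higher_pderiv field_simps)
qed

lemma coeff_rodrigues_neq_0:
  assumes "\<tau> \<noteq> 0"
  shows "coeff (rodrigues \<tau> k) k \<noteq> 0"
  using degree_rodrigues[OF assms, of k] poly_rodrigues_0[OF assms, of k]
  by (metis leading_coeff_0_iff poly_0 zero_neq_one)

text \<open>Integrating by parts \<open>k\<close> times moves the derivatives of Rodrigues' formula
  onto the conjugate of \<open>g\<close>, whose derivative of order \<open>k\<close> is
  zero.\<close>

lemma rodrigues_orthogonal:
  assumes "\<tau> \<ge> 0" and "\<And>i. i \<ge> k \<Longrightarrow> coeff g i = 0"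
  shows "poly_inner \<tau> (rodrigues \<tau> k) g = 0"
proof -
  have "(pderiv ^^ k) (map_poly cnj g) = 0"
    by (intro higher_pderiv_eq_0) (simp add: coeff_map_poly assms)
  then have "integral {-\<tau>..0} (\<lambda>\<theta>. poly ((pderiv ^^ k) (rodrigues_weight \<tau> k) * map_poly cnj g)
      (complex_of_real \<theta>)) = 0"
    using assms(1)
    by (intro integral_higher_pderiv_mult_eq_0)
      (auto simp: poly_rodrigues_weight_at_0 poly_rodrigues_weight_at_minus_tau)
  then show ?thesis
    by (simp add: rodrigues_def poly_inner_smult_left poly_inner_eq)
qed

lemma is_shifted_legendre_rodrigues:
  assumes "\<tau> > 0"
  shows "is_shifted_legendre \<tau> (rodrigues \<tau>)"
proof -
  have less: "poly_inner \<tau> (rodrigues \<tau> k) (rodrigues \<tau> j) = 0" if "j < k" for j k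
    using that assms
    by (intro rodrigues_orthogonal) (auto simp: degree_rodrigues intro!: coeff_eq_0)
  have "poly_inner \<tau> (rodrigues \<tau> j) (rodrigues \<tau> k) = 0" if "j \<noteq> k" for j k
    using that less poly_inner_commute[of \<tau> "rodrigues \<tau> j" "rodrigues \<tau> k"]
    by (cases j k rule: linorder_cases) (auto simp: less)
  then show ?thesis
    using assms by (simp add: is_shifted_legendre_def degree_rodrigues poly_rodrigues_0)
qed

section \<open>Uniqueness of the Legendre family\<close>

text \<open>The \<open>P j\<close> with \<open>j < k\<close> span the polynomials of degree below
  \<open>k\<close>: each induction step removes the top coefficient of \<open>g\<close> by a
  multiple of one \<open>P j\<close>.\<close>

lemma poly_inner_lower_degree_eq_0:
  assumes "\<And>j. degree (P j) = j" "\<And>j. P j \<noteq> 0"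
    and "\<And>j. j < k \<Longrightarrow> poly_inner \<tau> (P j) f = 0"
    and "\<And>i. i \<ge> k \<Longrightarrow> coeff g i = 0"
  shows "poly_inner \<tau> g f = 0"
  using assms(3,4)
proof (induction k arbitrary: g)
  case 0
  then have "g = 0" by (simp add: poly_eq_iff)
  then show ?case by simp
next
  case (Suc k)
  define a where "a = coeff g k / coeff (P k) k"
  have nz: "coeff (P k) k \<noteq> 0"
    using assms(1,2)[of k] by (metis leading_coeff_0_iff)
  have "coeff (g - smult a (P k)) i = 0" if "i \<ge> k" for i
  proof (cases "i = k")
    case False
    then show ?thesis using that Suc.prems(2)[of i] assms(1)[of k] by (simp add: coeff_eq_0)
  qed (use nz in \<open>simp add: a_def\<close>)
  then have "poly_inner \<tau> (g - smult a (P k)) f = 0"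
    using Suc by simp
  then show ?case
    using Suc.prems by (simp add: poly_inner_diff_left poly_inner_smult_left)
qed

text \<open>If \<open>c\<close> cancels the top coefficient, \<open>Q k - c P k\<close> has degree
  below \<open>k\<close> and is orthogonal to all lower \<open>P j\<close>, which agree with
  \<open>Q j\<close> by induction. Hence it is orthogonal to itself and zero, and the values at 0
  force \<open>c = 1\<close>.\<close>

lemma is_shifted_legendre_unique:
  assumes "\<tau> > 0" and P: "is_shifted_legendre \<tau> P" and Q: "is_shifted_legendre \<tau> Q"
  shows "Q = P"
proof
  fix k
  have degP: "degree (P j) = j" and degQ: "degree (Q j) = j"
    and P0: "poly (P j) 0 = 1" and Q0: "poly (Q j) 0 = 1" for j
    using P Q by (auto simp: is_shifted_legendre_def)
  have nz: "P j \<noteq> 0" for j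
    using P0[of j] by auto
  show "Q k = P k"
  proof (induction k rule: less_induct)
    case (less k)
    define c where "c = coeff (Q k) k / coeff (P k) k"
    define g where "g = Q k - smult c (P k)"
    have "coeff (P k) k \<noteq> 0" using nz[of k] degP[of k] by (metis leading_coeff_0_iff)
    then have low: "coeff g i = 0" if "i \<ge> k" for i
      using that degP[of k] degQ[of k]
      by (cases "i = k") (auto simp: g_def c_def coeff_eq_0)
    have "poly_inner \<tau> g f = 0"
      if "\<And>j. j < k \<Longrightarrow> poly_inner \<tau> (P j) f = 0" for f
      using poly_inner_lower_degree_eq_0[of P k \<tau> f g] degP nz that low by blast
    moreover have "poly_inner \<tau> (P j) g = 0" if "j < k" for j
    proof -
      have "poly_inner \<tau> (Q k) (P j) = 0"
        using Q that less[OF that] by (metis is_shifted_legendre_def less_irrefl)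
      moreover have "poly_inner \<tau> (P k) (P j) = 0"
        using P that by (auto simp: is_shifted_legendre_def)
      ultimately have "poly_inner \<tau> g (P j) = 0"
        by (simp add: g_def poly_inner_diff_left poly_inner_smult_left)
      then show ?thesis
        by (subst poly_inner_commute) simp
    qed
    ultimately have "g = 0"
      using poly_inner_self_eq_0_iff[OF assms(1)] by blast
    then have "Q k = smult c (P k)" by (simp add: g_def)
    moreover from this have "c = 1"
      using P0[of k] Q0[of k] by simp
    ultimately show ?case by simp
  qed
qed

lemma shifted_legendre_eq_rodrigues:
  assumes "\<tau> > 0"
  shows "shifted_legendre \<tau> = rodrigues \<tau>"
  unfolding shifted_legendre_def
  using assms is_shifted_legendre_rodrigues is_shifted_legendre_unique by blast

section \<open>The truncation in terms of top coefficients\<close>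

text \<open>Subtracting the multiple of \<open>rodrigues \<tau> N\<close> that cancels the
  coefficient at \<open>N\<close> leaves a remainder orthogonal to it, so this multiple is the
  orthogonal projection. From here on no inner product is needed.\<close>

lemma tau_trunc_component:
  fixes \<xi> :: "complex poly ^ 'n"
  assumes "\<tau> > 0" and "degree (\<xi> $ i) \<le> N"
  shows "tau_trunc \<tau> N \<xi> $ i =
    \<xi> $ i - smult (coeff (\<xi> $ i) N / coeff (rodrigues \<tau> N) N) (rodrigues \<tau> N)"
proof -
  let ?L = "rodrigues \<tau> N" and ?a = "coeff (\<xi> $ i) N / coeff (rodrigues \<tau> N) N"
  have deg: "degree ?L = N" and L: "?L \<noteq> 0"
    using assms degree_rodrigues[of \<tau> N] poly_rodrigues_0[of \<tau> N] by auto
  have "coeff ?L N \<noteq> 0"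
    using assms by (simp add: coeff_rodrigues_neq_0)
  then have low: "coeff (\<xi> $ i - smult ?a ?L) j = 0" if "j \<ge> N" for j
    using that deg assms(2) by (cases "j = N") (auto simp: coeff_eq_0)
  have "poly_inner \<tau> ?L (\<xi> $ i - smult ?a ?L) = 0"
    using assms(1) by (intro rodrigues_orthogonal low) simp_all
  then have "poly_inner \<tau> (\<xi> $ i - smult ?a ?L) ?L = 0"
    by (subst poly_inner_commute) (simp only: complex_cnj_zero)
  then have "poly_inner \<tau> (\<xi> $ i) ?L / poly_inner \<tau> ?L ?L = ?a"
    using L assms(1)
    by (simp add: poly_inner_diff_left poly_inner_smult_left poly_inner_self_eq_0_iff)
  then show ?thesis
    using assms(1) by (simp add: tau_trunc_def shifted_legendre_eq_rodrigues poly_norm_square)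
qed

section \<open>Solving the scalar tau equation\<close>

text \<open>\<open>neumann N t\<close> inverts \<open>1 - t \<D>\<close> on polynomials of degree at most \<open>N\<close>.\<close>

definition neumann :: "nat \<Rightarrow> complex \<Rightarrow> complex poly \<Rightarrow> complex poly" where
  "neumann N t h = (\<Sum>k\<le>N. smult (t ^ k) ((pderiv ^^ k) h))"

lemma neumann_0_left [simp]: "neumann N 0 h = h"
  by (simp add: neumann_def power_0_left if_distrib[of "\<lambda>x. smult x _"] cong: if_cong)

lemma neumann_0_right [simp]: "neumann N t 0 = 0"
  by (simp add: neumann_def)

text \<open>The sum telescopes to \<open>h\<close> minus a term with the derivative of order
  \<open>N + 1\<close>, which the degree bound makes zero.\<close>

lemma neumann_minus_pderiv:
  assumes "degree h \<le> N"
  shows "neumann N t h - smult t (pderiv (neumann N t h)) = h"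
proof -
  have "neumann N t h - smult t (pderiv (neumann N t h)) =
    h - smult (t ^ Suc N) ((pderiv ^^ Suc N) h)"
  proof (induction N)
    case (Suc N)
    let ?T = "smult (t ^ Suc N) ((pderiv ^^ Suc N) h)"
    have "neumann (Suc N) t h - smult t (pderiv (neumann (Suc N) t h)) =
      neumann N t h - smult t (pderiv (neumann N t h)) + ?T - smult t (pderiv ?T)"
      by (simp add: neumann_def pderiv_add smult_add_right)
    then show ?case
      unfolding Suc by (simp add: pderiv_smult)
  qed (simp add: neumann_def)
  moreover have "(pderiv ^^ Suc N) h = 0"
    using assms by (intro higher_pderiv_eq_0 coeff_eq_0) auto
  ultimately show ?thesis by (metis diff_zero smult_0_right)
qed

lemma degree_neumann:
  assumes "degree h \<le> N"
  shows "degree (neumann N t h) \<le> N"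
  unfolding neumann_def using assms
  by (intro degree_sum_le order_trans[OF degree_smult_le]) (auto simp: degree_higher_pderiv)

text \<open>In the equation \<open>neumann_minus_pderiv\<close> the derivative contributes nothing
  to the coefficient at \<open>N\<close>.\<close>

lemma coeff_neumann:
  assumes "degree h \<le> N"
  shows "coeff (neumann N t h) N = coeff h N"
proof -
  have "coeff (pderiv (neumann N t h)) N = 0"
    using degree_neumann[OF assms, of t] by (simp add: coeff_pderiv coeff_eq_0)
  then show ?thesis
    using arg_cong[OF neumann_minus_pderiv[OF assms, of t], of "\<lambda>p. coeff p N"] by simp
qed

lemma smult_minus_pderiv_inject:
  fixes x y :: "complex poly"
  assumes "s \<noteq> 0" "smult s x - pderiv x = smult s y - pderiv y"
  shows "x = y"
proof (rule ccontr)
  define d where "d = x - y"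
  assume "x \<noteq> y"
  then have "d \<noteq> 0" by (simp add: d_def)
  have eq: "smult s d = pderiv d"
    using assms(2) by (simp add: d_def smult_diff_right pderiv_diff algebra_simps)
  \<comment> \<open>Differentiation lowers every positive degree, so \<open>d\<close> must be
    constant.\<close>
  then have "degree d = degree (pderiv d)"
    using assms(1) by (metis degree_smult_eq)
  then have "pderiv d = 0"
    by (simp add: degree_pderiv pderiv_eq_0_iff)
  with eq \<open>d \<noteq> 0\<close> assms(1) show False by simp
qed

text \<open>The equation reads \<open>s x - x' = g + s a L\<close>, where \<open>a\<close> is the
  ratio of top coefficients of \<open>x\<close> and \<open>L\<close>. It is solved for each
  \<open>a\<close> as if \<open>a\<close> were given; the solution then has exactly this ratio, so
  \<open>a\<close> remains free.\<close>

lemma tau_equation_iff: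
  fixes x g L :: "complex poly"
  assumes "s \<noteq> 0" "degree x \<le> N" "degree g \<le> N" "coeff g N = 0" "degree L \<le> N" "coeff L N \<noteq> 0"
  shows "smult s (x - smult (coeff x N / coeff L N) L) - pderiv x = g \<longleftrightarrow>
    (\<exists>a. x = smult (inverse s) (neumann N (inverse s) g) + smult a (neumann N (inverse s) L))"
    (is "?lhs \<longleftrightarrow> (\<exists>a. x = ?sol a)")
proof -
  have inv: "smult s (neumann N (inverse s) h) - pderiv (neumann N (inverse s) h) = smult s h"
    if "degree h \<le> N" for h
    using arg_cong[OF neumann_minus_pderiv[OF that, of "inverse s"], of "smult s"] assms(1)
    by (simp add: smult_diff_right)
  have sol: "smult s (?sol a) - pderiv (?sol a) = g + smult (s * a) L" for a
  proof -
    have "smult s (?sol a) - pderiv (?sol a) =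
      smult (inverse s) (smult s (neumann N (inverse s) g) - pderiv (neumann N (inverse s) g)) +
      smult a (smult s (neumann N (inverse s) L) - pderiv (neumann N (inverse s) L))"
      by (simp add: pderiv_add pderiv_smult smult_add_right smult_diff_right algebra_simps)
    also have "\<dots> = g + smult (s * a) L"
      using assms by (simp add: inv mult.commute)
    finally show ?thesis .
  qed
  have lhs: "?lhs \<longleftrightarrow> smult s x - pderiv x = g + smult (s * (coeff x N / coeff L N)) L"
    by (auto simp: smult_diff_right algebra_simps)
  show ?thesis
  proof
    assume ?lhs
    then have "smult s x - pderiv x = smult s (?sol (coeff x N / coeff L N)) - pderiv (?sol (coeff x N / coeff L N))"
      unfolding lhs sol .
    then show "\<exists>a. x = ?sol a"
      using smult_minus_pderiv_inject[OF assms(1)] by blast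
  next
    assume "\<exists>a. x = ?sol a"
    then obtain a where x: "x = ?sol a" ..
    \<comment> \<open>Consistency of the parameter: \<open>neumann\<close> preserves the coefficient
      at \<open>N\<close>, and that of \<open>g\<close> is zero.\<close>
    have "coeff x N / coeff L N = a"
      using assms by (simp add: x coeff_neumann)
    then show ?lhs
      unfolding lhs using sol[of a] x by simp
  qed
qed

section \<open>The Pad\'e approximant\<close>

text \<open>This is \<open>r(\<theta>)\<close> cleared of negative powers of \<open>s\<close> by the
  factor \<open>s ^ N\<close>. It serves as numerator at \<open>\<theta> = -\<tau>\<close> and as
  denominator at \<open>\<theta> = 0\<close>.\<close>

definition legendre_numer :: "real \<Rightarrow> nat \<Rightarrow> complex \<Rightarrow> complex poly" where
  "legendre_numer \<tau> N \<theta> = (\<Sum>m\<le>N. monom (poly ((pderiv ^^ (N - m)) (rodrigues \<tau> N)) \<theta>) m)"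

definition legendre_pade :: "real \<Rightarrow> nat \<Rightarrow> complex \<Rightarrow> complex" where
  "legendre_pade \<tau> N s =
     poly (legendre_numer \<tau> N (- of_real \<tau>)) s / poly (legendre_numer \<tau> N 0) s"

lemma coeff_legendre_numer:
  "coeff (legendre_numer \<tau> N \<theta>) m =
     (if m \<le> N then poly ((pderiv ^^ (N - m)) (rodrigues \<tau> N)) \<theta> else 0)"
  by (simp add: legendre_numer_def coeff_sum)

lemma degree_legendre_numer: "degree (legendre_numer \<tau> N \<theta>) \<le> N"
  by (rule degree_le) (simp add: coeff_legendre_numer)

lemma poly_legendre_numer:
  assumes "s \<noteq> 0"
  shows "poly (legendre_numer \<tau> N \<theta>) s = s ^ N * poly (neumann N (inverse s) (rodrigues \<tau> N)) \<theta>"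
proof -
  have "poly (legendre_numer \<tau> N \<theta>) s =
    (\<Sum>k\<le>N. poly ((pderiv ^^ k) (rodrigues \<tau> N)) \<theta> * s ^ (N - k))"
    unfolding legendre_numer_def poly_sum poly_monom
    by (rule sum.reindex_bij_witness[where i = "\<lambda>k. N - k" and j = "\<lambda>k. N - k"]) auto
  also have "\<dots> = s ^ N * poly (neumann N (inverse s) (rodrigues \<tau> N)) \<theta>"
    unfolding neumann_def poly_sum sum_distrib_left using assms
    by (intro sum.cong) (simp_all add: power_diff power_inverse field_simps)
  finally show ?thesis .
qed

lemma legendre_pade_eq:
  assumes "s \<noteq> 0"
  shows "legendre_pade \<tau> N s = poly (neumann N (inverse s) (rodrigues \<tau> N)) (- of_real \<tau>) /
    poly (neumann N (inverse s) (rodrigues \<tau> N)) 0"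
  using assms by (simp add: legendre_pade_def poly_legendre_numer)

text \<open>For \<open>m > N\<close> both sides vanish, the right one because the order
  \<open>2 * N - m\<close> is below \<open>N\<close>. One formula thus covers all orders up to
  \<open>2 * N\<close>.\<close>

lemma coeff_legendre_numer_weight:
  assumes "m \<le> 2 * N" "\<theta> = 0 \<or> \<theta> = - of_real \<tau>"
  shows "coeff (legendre_numer \<tau> N \<theta>) m =
    poly ((pderiv ^^ (2 * N - m)) (rodrigues_weight \<tau> N)) \<theta> / (fact N * of_real \<tau> ^ N)"
proof (cases "m \<le> N")
  case True
  then have "(pderiv ^^ (N - m)) ((pderiv ^^ N) (rodrigues_weight \<tau> N)) =
    (pderiv ^^ (2 * N - m)) (rodrigues_weight \<tau> N)"
    by (simp add: mult_2 flip: funpow_add[THEN fun_cong, unfolded o_apply])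
  then show ?thesis
    using True by (simp add: coeff_legendre_numer rodrigues_def higher_pderiv_smult)
next
  case False
  then have "2 * N - m < N" using assms by simp
  then show ?thesis
    using False assms
    by (auto simp: coeff_legendre_numer poly_rodrigues_weight_at_0 poly_rodrigues_weight_at_minus_tau)
qed

text \<open>Up to a constant, the left-hand side is the derivative of order \<open>2 N - m\<close> of the Rodrigues
  weight at \<open>-\<tau>\<close>, a polynomial of degree \<open>m\<close>; its Taylor expansion at \<open>0\<close> is the convolution
  on the right.\<close>

lemma coeff_legendre_numer_exp:
  assumes "m \<le> 2 * N"
  shows "coeff (legendre_numer \<tau> N (- of_real \<tau>)) m =
    fps_nth (fps_exp (- of_real \<tau>) * fps_of_poly (legendre_numer \<tau> N 0)) m"
proof -
  define w where "w = rodrigues_weight \<tau> N"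
  define c where "c = (fact N * of_real \<tau> ^ N :: complex)"
  have "degree ((pderiv ^^ (2 * N - m)) w) = m"
    using assms by (simp add: w_def degree_higher_pderiv degree_rodrigues_weight)
  then have "poly ((pderiv ^^ (2 * N - m)) w) (- of_real \<tau>) =
    (\<Sum>i\<le>m. coeff ((pderiv ^^ (2 * N - m)) w) i * (- of_real \<tau>) ^ i)"
    by (simp add: poly_altdef)
  \<comment> \<open>The Taylor coefficient at \<open>i\<close> is a derivative at 0 of total order
    \<open>i + (2 * N - m)\<close>, divided by \<open>fact i\<close>.\<close>
  also have "\<dots> = (\<Sum>i\<le>m. (- of_real \<tau>) ^ i / fact i * poly ((pderiv ^^ (2 * N - (m - i))) w) 0)"
  proof (rule sum.cong)
    fix i assume "i \<in> {..m}"
    then have "i + (2 * N - m) = 2 * N - (m - i)" using assms by simp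
    then have "(pderiv ^^ i) ((pderiv ^^ (2 * N - m)) w) = (pderiv ^^ (2 * N - (m - i))) w"
      by (simp flip: funpow_add[THEN fun_cong, unfolded o_apply])
    then show "coeff ((pderiv ^^ (2 * N - m)) w) i * (- of_real \<tau>) ^ i =
      (- of_real \<tau>) ^ i / fact i * poly ((pderiv ^^ (2 * N - (m - i))) w) 0"
      by (simp add: coeff_eq_higher_pderiv[of _ i])
  qed simp
  also have "\<dots> / c = (\<Sum>i\<le>m. (- of_real \<tau>) ^ i / fact i * coeff (legendre_numer \<tau> N 0) (m - i))"
    unfolding sum_divide_distrib using assms
    by (intro sum.cong) (auto simp: coeff_legendre_numer_weight w_def c_def)
  finally show ?thesis
    using assms by (simp add: coeff_legendre_numer_weight w_def c_def fps_mult_nth atLeast0AtMost)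
qed

text \<open>A unit can be cancelled modulo terms of order above \<open>n\<close>, since a product's
  coefficients up to \<open>n\<close> depend only on those of its factors up to
  \<open>n\<close>.\<close>

lemma fps_nth_eq_of_mult_unit:
  fixes F G H :: "'a::field fps"
  assumes "fps_nth H 0 \<noteq> 0" and "\<And>m. m \<le> n \<Longrightarrow> fps_nth (F * H) m = fps_nth (G * H) m"
  shows "fps_nth F n = fps_nth G n"
proof -
  have H: "H * inverse H = 1" using assms(1) by (simp add: inverse_mult_eq_1')
  have "fps_nth (F * H * inverse H) n = fps_nth (G * H * inverse H) n"
    unfolding fps_mult_nth[of _ "inverse H"] using assms(2) by (intro sum.cong) auto
  then show ?thesis
    by (simp only: mult.assoc H mult_1_right)
qed

lemma is_pade_exp_legendre_pade:
  assumes "\<tau> \<noteq> 0"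
  shows "is_pade_exp \<tau> N (legendre_pade \<tau> N)"
proof -
  let ?p = "legendre_numer \<tau> N (- of_real \<tau>)" and ?q = "legendre_numer \<tau> N 0"
  define F where "F = fps_of_poly ?p / fps_of_poly ?q"
  \<comment> \<open>The denominator at \<open>s = 0\<close> is a nonzero multiple of the leading
    coefficient of the Legendre polynomial, so the quotient is analytic there.\<close>
  have "coeff ?q 0 = fact N * coeff (rodrigues \<tau> N) N"
    by (simp add: coeff_legendre_numer coeff_eq_higher_pderiv[of _ N])
  then have q0: "coeff ?q 0 \<noteq> 0"
    using coeff_rodrigues_neq_0[OF assms] by simp
  have poly_exp: "poly r has_fps_expansion fps_of_poly r" for r :: "complex poly"
    using eval_fps_has_fps_expansion[of "fps_of_poly r"] by (simp add: eval_fps_of_poly[abs_def])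
  have exp: "legendre_pade \<tau> N has_fps_expansion F"
    unfolding legendre_pade_def[abs_def] F_def
    using q0 by (intro has_fps_expansion_divide' poly_exp) simp
  have "legendre_pade \<tau> N analytic_on {0}"
    using has_fps_expansion_imp_holomorphic[OF exp] by (metis analytic_at)
  moreover have "(deriv ^^ m) (legendre_pade \<tau> N) 0 = (- complex_of_real \<tau>) ^ m" if "m \<le> 2 * N" for m
  proof -
    have "F * fps_of_poly ?q = fps_of_poly ?p"
      using q0 by (simp add: F_def fps_divide_unit mult.assoc inverse_mult_eq_1)
    then have "fps_nth (F * fps_of_poly ?q) i =
        fps_nth (fps_exp (- of_real \<tau>) * fps_of_poly ?q) i" if "i \<le> m" for i
      using that \<open>m \<le> 2 * N\<close> by (simp add: coeff_legendre_numer_exp)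
    then have "fps_nth F m = fps_nth (fps_exp (- of_real \<tau>)) m"
      using fps_nth_eq_of_mult_unit[of "fps_of_poly ?q" m F] q0 by simp
    then show ?thesis
      by (simp add: fps_nth_fps_expansion[OF exp])
  qed
  moreover have "?q \<noteq> 0 \<and> degree ?p \<le> N \<and> degree ?q \<le> N \<and>
    (\<forall>s. poly ?q s \<noteq> 0 \<longrightarrow> legendre_pade \<tau> N s = poly ?p s / poly ?q s)"
    using q0 by (auto simp: degree_legendre_numer legendre_pade_def)
  ultimately show ?thesis
    unfolding is_pade_exp_def by blast
qed

section \<open>Invertibility of the delay matrix\<close>

text \<open>Evaluation is a ring homomorphism. A determinant with polynomial entries is thus itself
  a polynomial, and if nonzero it has only finitely many roots.\<close>

lemma poly_det:
  fixes K :: "'a::comm_ring_1 poly ^ 'n ^ 'n"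
  shows "poly (det K) t = det (\<chi> i j. poly (K $ i $ j) t)"
proof -
  have "poly (of_int c) t = of_int c" for c :: int
    by (simp add: of_int_poly)
  then show ?thesis
    by (simp add: det_def poly_sum poly_prod)
qed

lemma MOST_poly_neq_0:
  fixes p :: "'a::idom poly"
  assumes "p \<noteq> 0"
  shows "MOST t. poly p t \<noteq> 0"
  using poly_roots_finite[OF assms] by (simp add: MOST_iff_cofinite)

lemma mat_matrix_mult: "mat c ** M = (\<chi> i j. c * M $ i $ j)"
  for M :: "'a::semiring_1 ^ 'n ^ 'm"
  by (simp add: matrix_matrix_mult_def mat_def vec_eq_iff if_distrib[of "\<lambda>x. x * _"] cong: if_cong)

lemma matrix_mult_mat: "M ** mat c = (\<chi> i j. M $ i $ j * c)"
  for M :: "'a::semiring_1 ^ 'n ^ 'm"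
  by (simp add: matrix_matrix_mult_def mat_def vec_eq_iff if_distrib[of "\<lambda>x. _ * x"] cong: if_cong)

lemma mat_vector_mult: "mat c *v x = c *s x"
  for x :: "'a::semiring_1 ^ 'n"
  by (simp add: matrix_vector_mult_def mat_def vec_eq_iff if_distrib[of "\<lambda>x. x * _"] cong: if_cong)

text \<open>The point \<open>\<theta>\<close> is fixed and \<open>t\<close> becomes the variable.
  For \<open>h = rodrigues \<tau> N\<close> the coefficients are those of
  \<open>legendre_numer\<close> in reverse order.\<close>

definition neumann_poly :: "nat \<Rightarrow> complex poly \<Rightarrow> complex \<Rightarrow> complex poly" where
  "neumann_poly N h \<theta> = (\<Sum>k\<le>N. monom (poly ((pderiv ^^ k) h) \<theta>) k)"

lemma poly_neumann_poly: "poly (neumann_poly N h \<theta>) t = poly (neumann N t h) \<theta>"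
  by (simp add: neumann_poly_def neumann_def poly_sum poly_monom mult.commute)

lemma MOST_poly_neumann_rodrigues_neq_0:
  assumes "\<tau> \<noteq> 0"
  shows "MOST t. poly (neumann N t (rodrigues \<tau> N)) 0 \<noteq> 0"
proof -
  have "poly (neumann_poly N (rodrigues \<tau> N) 0) 0 = 1"
    by (simp add: poly_neumann_poly poly_rodrigues_0 assms)
  then have "neumann_poly N (rodrigues \<tau> N) 0 \<noteq> 0" by auto
  from MOST_poly_neq_0[OF this] show ?thesis
    by (simp only: poly_neumann_poly)
qed

text \<open>Write \<open>t = 1 / s\<close>, and \<open>Q(t)\<close> for the denominator of the approximant in terms of \<open>t\<close>. Then
  \<open>t Q(t) (s I - A\<^sub>0 - A\<^sub>1 R(s))\<close> has entries polynomial in \<open>t\<close> and is the identity at \<open>t = 0\<close>,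
  that is, at \<open>s = \<infinity>\<close>.\<close>

lemma MOST_invertible_delay_matrix:
  fixes A0 A1 :: "complex ^ 'n ^ 'n"
  assumes "\<tau> \<noteq> 0"
  shows "MOST s. invertible (delay_matrix A0 A1 (legendre_pade \<tau> N) s)"
proof -
  define Q where "Q = neumann_poly N (rodrigues \<tau> N) 0"
  define P where "P = neumann_poly N (rodrigues \<tau> N) (- of_real \<tau>)"
  define K :: "complex poly ^ 'n ^ 'n" where
    "K = (\<chi> i j. (if i = j then Q else 0) -
      smult (A0 $ i $ j) (monom 1 1 * Q) - smult (A1 $ i $ j) (monom 1 1 * P))"
  have K: "(\<chi> i j. poly (K $ i $ j) t) = (\<chi> i j. (if i = j then poly Q t else 0) -
      A0 $ i $ j * (t * poly Q t) - A1 $ i $ j * (t * poly P t))" for t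
    by (simp add: K_def vec_eq_iff poly_monom)
  have "poly Q 0 = 1"
    by (simp add: Q_def poly_neumann_poly poly_rodrigues_0 assms)
  then have "(\<chi> i j. poly (K $ i $ j) 0) = mat 1"
    unfolding K by (simp add: mat_def cong: if_cong)
  then have "poly (det K) 0 = 1"
    by (simp add: poly_det)
  then have "det K \<noteq> 0" by auto
  from MOST_poly_neq_0[OF this] have "MOST t. det (\<chi> i j. poly (K $ i $ j) t) \<noteq> 0"
    by (simp only: poly_det)
  \<comment> \<open>With \<open>inverse 0 = 0\<close>, inversion is injective on all of \<complex>,
    so substituting \<open>t = 1 / s\<close> keeps the exceptions finite.\<close>
  then have "MOST s. det (\<chi> i j. poly (K $ i $ j) (inverse s)) \<noteq> 0"
    by (rule MOST_inj) (simp add: inj_on_def)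
  moreover have "MOST t. poly Q t \<noteq> 0"
    using MOST_poly_neumann_rodrigues_neq_0[OF assms] by (simp add: Q_def poly_neumann_poly)
  then have "MOST s. poly Q (inverse s) \<noteq> 0"
    by (rule MOST_inj) (simp add: inj_on_def)
  moreover have "MOST s :: complex. s \<noteq> 0"
    by simp
  ultimately show ?thesis
  proof eventually_elim
    case (elim s)
    let ?M = "delay_matrix A0 A1 (legendre_pade \<tau> N) s"
    have "legendre_pade \<tau> N s = poly P (inverse s) / poly Q (inverse s)"
      using elim by (simp add: legendre_pade_eq P_def Q_def poly_neumann_poly)
    then have "(\<chi> i j. poly (K $ i $ j) (inverse s)) = mat (inverse s * poly Q (inverse s)) ** ?M"
      using elim unfolding K mat_matrix_mult delay_matrix_def matrix_mult_mat
      by (simp add: vec_eq_iff mat_def field_simps)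
    then have "det ?M \<noteq> 0"
      using elim by (auto simp: det_mul)
    then show ?case
      by (simp add: invertible_det_nz)
  qed
qed

section \<open>Inverting the pencil\<close>

lemma matrix_inv_mult_eq_iff:
  fixes M :: "'a::field ^ 'n ^ 'n"
  assumes "invertible M"
  shows "M *v x = y \<longleftrightarrow> x = matrix_inv M *v y"
proof -
  have "\<exists>M'. M ** M' = mat 1 \<and> M' ** M = mat 1"
    using assms by (simp add: invertible_def)
  then have "M ** matrix_inv M = mat 1 \<and> matrix_inv M ** M = mat 1"
    unfolding matrix_inv_def by (rule someI_ex)
  then show ?thesis
    by (metis matrix_vector_mul_assoc matrix_vector_mul_lid)
qed

text \<open>The general solution of the polynomial row with right-hand side \<open>g\<close>; the
  vector \<open>a\<close> holds one free parameter per component.\<close>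

definition tau_solution :: "real \<Rightarrow> nat \<Rightarrow> complex \<Rightarrow> complex poly ^ 'n \<Rightarrow> complex ^ 'n \<Rightarrow>
    complex poly ^ 'n" where
  "tau_solution \<tau> N s g a = (\<chi> i. smult (inverse s) (neumann N (inverse s) (g $ i)) +
     smult (a $ i) (neumann N (inverse s) (rodrigues \<tau> N)))"

text \<open>The share of \<open>g\<close> in the boundary row. It is zero for the input
  \<open>(B v, 0)\<close>, but bijectivity of the pencil concerns every \<open>g\<close>.\<close>

definition tau_residual :: "real \<Rightarrow> nat \<Rightarrow> complex ^ 'n ^ 'n \<Rightarrow> complex ^ 'n ^ 'n \<Rightarrow> complex \<Rightarrow>
    complex poly ^ 'n \<Rightarrow> complex ^ 'n" where
  "tau_residual \<tau> N A0 A1 s g = fst (tau_pencil \<tau> N A0 A1 s (tau_solution \<tau> N s g 0))"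

lemma tau_solution_in_vec_polys:
  assumes "\<tau> \<noteq> 0" "g \<in> vec_polys N"
  shows "tau_solution \<tau> N s g a \<in> vec_polys N"
  using assms
  by (auto simp: vec_polys_def tau_solution_def degree_rodrigues
      intro!: degree_add_le order_trans[OF degree_smult_le] degree_neumann)

lemma eval_at_tau_solution:
  "eval_at \<theta> (tau_solution \<tau> N s g a) = eval_at \<theta> (tau_solution \<tau> N s g 0) +
     poly (neumann N (inverse s) (rodrigues \<tau> N)) (of_real \<theta>) *s a"
  by (simp add: eval_at_def tau_solution_def vec_eq_iff)

lemma eval_at_tau_solution_0 [simp]: "eval_at \<theta> (tau_solution \<tau> N s 0 0) = 0"
  by (simp add: eval_at_def tau_solution_def vec_eq_iff)

text \<open>The boundary row is affine in \<open>a\<close>. Since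
  \<open>r(-\<tau>) = R(s) r(0)\<close>, its linear part is the delay matrix applied to
  \<open>r(0) a\<close>.\<close>

lemma fst_tau_pencil_solution:
  fixes A0 A1 :: "complex ^ 'n ^ 'n"
  assumes "s \<noteq> 0" "poly (neumann N (inverse s) (rodrigues \<tau> N)) 0 \<noteq> 0"
  shows "fst (tau_pencil \<tau> N A0 A1 s (tau_solution \<tau> N s g a)) =
    tau_residual \<tau> N A0 A1 s g + delay_matrix A0 A1 (legendre_pade \<tau> N) s *v
      (poly (neumann N (inverse s) (rodrigues \<tau> N)) 0 *s a)"
proof -
  define u where "u \<theta> = eval_at \<theta> (tau_solution \<tau> N s g 0)" for \<theta>
  define z where "z = poly (neumann N (inverse s) (rodrigues \<tau> N)) 0 *s a"
  have "eval_at 0 (tau_solution \<tau> N s g a) = u 0 + z"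
    by (subst eval_at_tau_solution) (simp add: u_def z_def)
  moreover have "eval_at (-\<tau>) (tau_solution \<tau> N s g a) = u (-\<tau>) + legendre_pade \<tau> N s *s z"
    using assms
    by (subst eval_at_tau_solution) (simp add: u_def z_def legendre_pade_eq vector_smult_assoc)
  ultimately show ?thesis
    by (simp add: tau_residual_def tau_pencil_eq delay_matrix_def matrix_vector_mult_diff_rdistrib
        matrix_vector_right_distrib mat_vector_mult vector_add_ldistrib
        flip: matrix_vector_mul_assoc u_def z_def)
qed

text \<open>The polynomial row determines the solution up to \<open>a\<close>; the boundary row then
  fixes \<open>a\<close>, because the delay matrix is invertible and \<open>r(0)\<close> is
  nonzero.\<close>

lemma tau_pencil_eq_iff:
  fixes A0 A1 :: "complex ^ 'n ^ 'n"
  assumes "\<tau> > 0" "N \<ge> 1" "s \<noteq> 0"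
    and r: "poly (neumann N (inverse s) (rodrigues \<tau> N)) 0 \<noteq> 0" (is "?r \<noteq> 0")
    and M: "invertible (delay_matrix A0 A1 (legendre_pade \<tau> N) s)" (is "invertible ?M")
    and "\<xi> \<in> vec_polys N" "g \<in> vec_polys (N - 1)"
  shows "tau_pencil \<tau> N A0 A1 s \<xi> = (b, g) \<longleftrightarrow>
    \<xi> = tau_solution \<tau> N s g
      (inverse ?r *s (matrix_inv ?M *v (b - tau_residual \<tau> N A0 A1 s g)))"
proof -
  \<comment> \<open>Here \<open>N \<ge> 1\<close> matters: it makes \<open>N - 1\<close> smaller
    than \<open>N\<close>, so \<open>g\<close> has no coefficient at \<open>N\<close>.\<close>
  have deg: "degree (\<xi> $ i) \<le> N" "degree (g $ i) \<le> N" "coeff (g $ i) N = 0" for i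
    using assms(2,6,7) coeff_eq_0[of "g $ i" N]
    by (auto simp: vec_polys_def intro: order_trans dest!: spec[of _ i])
  have "snd (tau_pencil \<tau> N A0 A1 s \<xi>) = g \<longleftrightarrow>
    (\<forall>i. \<exists>c. \<xi> $ i = smult (inverse s) (neumann N (inverse s) (g $ i)) +
       smult c (neumann N (inverse s) (rodrigues \<tau> N)))"
  proof -
    have "snd (tau_pencil \<tau> N A0 A1 s \<xi>) = g \<longleftrightarrow>
      (\<forall>i. smult s (\<xi> $ i - smult (coeff (\<xi> $ i) N / coeff (rodrigues \<tau> N) N) (rodrigues \<tau> N)) -
        pderiv (\<xi> $ i) = g $ i)"
      using assms(1) deg by (simp add: tau_pencil_eq vec_eq_iff tau_trunc_component vec_pderiv_def)
    then show ?thesis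
      using assms(1) tau_equation_iff[OF assms(3) deg] by (simp add: degree_rodrigues coeff_rodrigues_neq_0)
  qed
  also have "\<dots> \<longleftrightarrow> (\<exists>a. \<xi> = tau_solution \<tau> N s g a)"
    by (simp add: tau_solution_def vec_eq_iff choice_iff) (metis vec_lambda_beta)
  finally have snd: "snd (tau_pencil \<tau> N A0 A1 s \<xi>) = g \<longleftrightarrow> (\<exists>a. \<xi> = tau_solution \<tau> N s g a)" .
  have fst: "fst (tau_pencil \<tau> N A0 A1 s (tau_solution \<tau> N s g a)) = b \<longleftrightarrow>
    a = inverse ?r *s (matrix_inv ?M *v (b - tau_residual \<tau> N A0 A1 s g))" for a
  proof -
    have "fst (tau_pencil \<tau> N A0 A1 s (tau_solution \<tau> N s g a)) = b \<longleftrightarrow>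
      ?M *v (?r *s a) = b - tau_residual \<tau> N A0 A1 s g"
      unfolding fst_tau_pencil_solution[OF assms(3) r] by (auto simp: algebra_simps)
    also have "\<dots> \<longleftrightarrow> ?r *s a = matrix_inv ?M *v (b - tau_residual \<tau> N A0 A1 s g)"
      by (rule matrix_inv_mult_eq_iff[OF M])
    also have "\<dots> \<longleftrightarrow> a = inverse ?r *s (matrix_inv ?M *v (b - tau_residual \<tau> N A0 A1 s g))"
      using r by (auto simp: vec_eq_iff field_simps)
    finally show ?thesis .
  qed
  have "tau_pencil \<tau> N A0 A1 s \<xi> = (b, g) \<longleftrightarrow>
    (\<exists>a. \<xi> = tau_solution \<tau> N s g a \<and> fst (tau_pencil \<tau> N A0 A1 s (tau_solution \<tau> N s g a)) = b)"
    using snd by (auto simp: prod_eq_iff)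
  then show ?thesis
    unfolding fst by blast
qed

lemma tau_pencil_in:
  fixes \<xi> :: "complex poly ^ 'n"
  assumes "\<tau> > 0" "N \<ge> 1" "\<xi> \<in> vec_polys N"
  shows "tau_pencil \<tau> N A0 A1 s \<xi> \<in> UNIV \<times> vec_polys (N - 1)"
proof -
  have "degree (smult s (tau_trunc \<tau> N \<xi> $ i) - pderiv (\<xi> $ i)) \<le> N - 1" for i
  proof -
    have deg: "degree (\<xi> $ i) \<le> N" using assms(3) by (simp add: vec_polys_def)
    have "coeff (tau_trunc \<tau> N \<xi> $ i) j = 0" if "j > N - 1" for j
    proof (cases "j = N")
      case False
      then have "j > N" using that by simp
      then show ?thesis
        using assms(1) deg by (simp add: tau_trunc_component coeff_eq_0 degree_rodrigues)
    qed (use assms(1) deg in \<open>simp add: tau_trunc_component coeff_rodrigues_neq_0\<close>)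
    moreover have "coeff (pderiv (\<xi> $ i)) j = 0" if "j > N - 1" for j
      using that deg by (simp add: coeff_pderiv coeff_eq_0)
    ultimately show ?thesis
      by (intro degree_le) auto
  qed
  then show ?thesis
    by (simp add: tau_pencil_eq vec_polys_def vec_pderiv_def)
qed

section \<open>Comparison of the transfer functions\<close>

theorem corollary4p3:
  fixes \<tau> :: real and N :: nat
    and A0 A1 :: "complex ^ 'n ^ 'n"
    and B :: "complex ^ 'p ^ 'n"
    and C :: "complex ^ 'n ^ 'q"
  assumes "\<tau> > 0" and "N \<ge> 1"
  shows "\<exists>R. is_pade_exp \<tau> N R \<and>
    (MOST s. bij_betw (tau_pencil \<tau> N A0 A1 s) (vec_polys N) (UNIV \<times> vec_polys (N - 1)) \<and>
       invertible (delay_matrix A0 A1 R s) \<and>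
       (\<forall>v. tau_transfer \<tau> N A0 A1 B C s v = delay_transfer A0 A1 B C R s *v v))"
proof (intro exI conjI)
  have \<tau>: "\<tau> \<noteq> 0" using assms by simp
  show "is_pade_exp \<tau> N (legendre_pade \<tau> N)"
    by (rule is_pade_exp_legendre_pade[OF \<tau>])
  have "MOST s. poly (neumann N (inverse s) (rodrigues \<tau> N)) 0 \<noteq> 0"
    by (rule MOST_inj[OF MOST_poly_neumann_rodrigues_neq_0[OF \<tau>]]) (simp add: inj_on_def)
  moreover have "MOST s :: complex. s \<noteq> 0"
    by simp
  ultimately show "MOST s. bij_betw (tau_pencil \<tau> N A0 A1 s) (vec_polys N) (UNIV \<times> vec_polys (N - 1)) \<and>
       invertible (delay_matrix A0 A1 (legendre_pade \<tau> N) s) \<and>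
       (\<forall>v. tau_transfer \<tau> N A0 A1 B C s v = delay_transfer A0 A1 B C (legendre_pade \<tau> N) s *v v)"
    using MOST_invertible_delay_matrix[OF \<tau>, of A0 A1 N]
  proof eventually_elim
    case (elim s)
    let ?M = "delay_matrix A0 A1 (legendre_pade \<tau> N) s"
    let ?r = "poly (neumann N (inverse s) (rodrigues \<tau> N)) 0"
    let ?f = "tau_pencil \<tau> N A0 A1 s"
    \<comment> \<open>The explicit inverse of the pencil, read off from
      \<open>tau_pencil_eq_iff\<close>.\<close>
    define sol where "sol = (\<lambda>(b, g). tau_solution \<tau> N s g
      (inverse ?r *s (matrix_inv ?M *v (b - tau_residual \<tau> N A0 A1 s g))))"
    have eq_iff: "?f \<xi> = y \<longleftrightarrow> \<xi> = sol y"
      if "\<xi> \<in> vec_polys N" "y \<in> UNIV \<times> vec_polys (N - 1)" for \<xi> y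
      using that tau_pencil_eq_iff[OF assms elim(2,1,3)] by (auto simp: sol_def)
    have sol_in: "sol y \<in> vec_polys N" if "y \<in> UNIV \<times> vec_polys (N - 1)" for y
    proof -
      have "vec_polys (N - 1) \<subseteq> vec_polys N"
        by (auto simp: vec_polys_def intro: order_trans)
      then have "snd y \<in> vec_polys N" using that by auto
      then show ?thesis
        by (simp add: sol_def case_prod_beta tau_solution_in_vec_polys[OF \<tau>])
    qed
    have bij: "bij_betw ?f (vec_polys N) (UNIV \<times> vec_polys (N - 1))"
    proof (rule bij_betwI[where g = sol])
      show "?f \<in> vec_polys N \<rightarrow> UNIV \<times> vec_polys (N - 1)"
        using tau_pencil_in[OF assms] by (rule Pi_I)
      show "sol \<in> UNIV \<times> vec_polys (N - 1) \<rightarrow> vec_polys N"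
        using sol_in by (rule Pi_I)
    next
      fix \<xi> :: "complex poly ^ 'n" assume "\<xi> \<in> vec_polys N"
      with eq_iff[OF this tau_pencil_in[OF assms this]] show "sol (?f \<xi>) = \<xi>"
        by metis
    next
      fix y :: "(complex ^ 'n) \<times> (complex poly ^ 'n)" assume "y \<in> UNIV \<times> vec_polys (N - 1)"
      with eq_iff[OF sol_in this] show "?f (sol y) = y"
        by metis
    qed
    have "tau_transfer \<tau> N A0 A1 B C s v = delay_transfer A0 A1 B C (legendre_pade \<tau> N) s *v v" for v
    proof -
      have y: "tau_B B v \<in> UNIV \<times> vec_polys (N - 1)"
        by (simp add: tau_B_def vec_polys_def)
      have "inv_into (vec_polys N) ?f (tau_B B v) = sol (tau_B B v)"
        using eq_iff[OF sol_in[OF y] y] bij_betw_imp_inj_on[OF bij] sol_in[OF y]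
        by (intro inv_into_f_eq) blast+
      moreover have "tau_residual \<tau> N A0 A1 s 0 = 0"
        by (simp add: tau_residual_def tau_pencil_eq)
      \<comment> \<open>With \<open>g = 0\<close> the solution takes the value
        \<open>?r *s a\<close> at 0, and the factor \<open>inverse ?r\<close> in \<open>a\<close>
        cancels.\<close>
      ultimately have "eval_at 0 (inv_into (vec_polys N) ?f (tau_B B v)) = matrix_inv ?M *v (B *v v)"
        using elim by (simp add: sol_def tau_B_def eval_at_tau_solution[of _ _ _ _ _ "_ *s _"])
      then show ?thesis
        by (simp add: tau_transfer_def tau_C_def delay_transfer_def matrix_vector_mul_assoc matrix_mul_assoc)
    qed
    with bij elim show ?case by blast
  qed
qed

end
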